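(* Let $I$ be an integer interval, let $\mathcal{MG}_I$ be the set of isomorphism classes of multigraphs with a weak harmonic labeling onto $I$, and let $\mathcal{MH}_I$ be the class of collections of non-trivial harmonic multisets of $\mathbb{Z}$ satisfying (MP1)–(MP5) of the context. Then the maps $$\mathcal{MG}_I\to\mathcal{MH}_I,\ (G,\ell)\mapsto\mathcal{MA}_{(G,\ell)}\qquad\text{and}\qquad \mathcal{MH}_I\to\mathcal{MG}_I,\ \mathcal{MA}\mapsto(G_{\mathcal{MA}},\ell_{\mathcal{MA}})$$ are mutually inverse.
   Context: Multigraphs are connected, loopless, of bounded degree, with at least three vertices; parallel edges are indistinguishable, so a multigraph $G$ is given by its vertex set $V_G$ and the numbers $m_G(v,w)=m_G(w,v)\in\mathbb{Z}_{\ge0}$ of edges between distinct vertices $v,w$. Write $v\sim w$ if $m_G(v,w)\neq0$, and $\deg(v)=\sum_{w\sim v}m_G(v,w)$. A vertex $v$ is a leaf if $m_G(v,w)\neq0$ for exactly one $w\neq v$; $S_G$ is the set of leaves. An integer interval is a (finite or infinite) set of consecutive integers. A weak harmonic labeling of $G$ onto $I$ is a bijection $\ell:V_G\to I$ with $\ell(v)=\frac{1}{\deg(v)}\sum_{w\sim v}m_G(v,w)\ell(w)$ for all $v\in V_G\setminus S_G$. An isomorphism $(G,\ell)\to(G',\ell')$ is a multigraph isomorphism $f:G\to G'$ with $\ell'(f(v))=\ell(v)$ for all $v\in V_G$. $\mathcal{MG}_I$ is the set of pairs $(G,\ell)$ with $\ell:V_G\to I$ a weak harmonic labeling, modulo isomorphism.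 A finite multiset is a pair $\mathcal{M}=(A_{\mathcal{M}},m)$ with $A_{\mathcal{M}}$ a nonempty finite set (the underlying set) and $m:A_{\mathcal{M}}\to\mathbb{N}$ giving the (positive) multiplicities; $|\mathcal{M}|=\sum_{x\in A_{\mathcal{M}}}m(x)$; $x^k\in\mathcal{M}$ means that $x\in A_{\mathcal{M}}$ with $m(x)=k$, and $x\in\mathcal{M}$ means $x\in A_{\mathcal{M}}$. For $A_{\mathcal{M}}\subset\mathbb{Z}$ let $av(\mathcal{M})=\frac{1}{|\mathcal{M}|}\sum_{k\in A_{\mathcal{M}}}m(k)k$. $\mathcal{M}$ is a harmonic multiset of $\mathbb{Z}$ if $av(\mathcal{M})\in A_{\mathcal{M}}$; it is trivial if $|A_{\mathcal{M}}|=1$. For $(G,\ell)\in\mathcal{MG}_I$, $\mathcal{MA}_{(G,\ell)}=\{\mathcal{B}_v: v\in V_G\setminus S_G\}$, where $\mathcal{B}_v=\{\ell(v)\}\cup\{\ell(w)^{m_G(v,w)}: w\sim v\}$. $\mathcal{MH}_I$ is the class of collections $\mathcal{MA}$ of non-trivial harmonic multisets of $\mathbb{Z}$ such that for all $\mathcal{B},\mathcal{C}\in\mathcal{MA}$: (MP1) $\bigcup_{\mathcal{D}\in\mathcal{MA}}A_{\mathcal{D}}=I$; (MP2) $av(\mathcal{B})\neq av(\mathcal{C})$ if $\mathcal{B}\neq\mathcal{C}$; (MP3) if $t\in A_{\mathcal{B}}\cap A_{\mathcal{C}}$, $\mathcal{B}\neq\mathcal{C}$, then there exists $\mathcal{D}\in\mathcal{MA}$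 with $av(\mathcal{D})=t$; (MP4) if $av(\mathcal{B})^k\in\mathcal{C}$ then $av(\mathcal{C})^k\in\mathcal{B}$; (MP5) there exists a sequence $\mathcal{B}_{i_1},\ldots,\mathcal{B}_{i_r}$ in $\mathcal{MA}$ with $\mathcal{B}_{i_1}=\mathcal{B}$, $\mathcal{B}_{i_r}=\mathcal{C}$ and $av(\mathcal{B}_{i_j})\in\mathcal{B}_{i_{j+1}}$ for $1\le j\le r-1$. For $\mathcal{MA}\in\mathcal{MH}_I$, $G_{\mathcal{MA}}$ is the multigraph with vertex set $I$ in which distinct $i,j$ are joined by $k\ge1$ edges if and only if there is $\mathcal{B}\in\mathcal{MA}$ with ($i=av(\mathcal{B})$ and $j^k\in\mathcal{B}$) or ($j=av(\mathcal{B})$ and $i^k\in\mathcal{B}$); and $\ell_{\mathcal{MA}}$ is the vertex labeling $\ell_{\mathcal{MA}}(i)=i$.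
   Formalization: Each multiset must contain its average with multiplicity one ({{0,1,1,2}} is a counterexample otherwise); uniformly bounded degree is paired with collections of bounded multiset size, and all collections with locally finite multigraphs, as unbounded degree can occur. *)

theory Defs
  imports Complex_Main "HOL-Library.Multiset"
begin

definition integer_interval :: "int set \<Rightarrow> bool" where
  "integer_interval I \<longleftrightarrow> I \<noteq> {} \<and> (\<forall>a\<in>I. \<forall>b\<in>I. {a..b} \<subseteq> I)"

text \<open>
  Parallel edges are indistinguishable, so a multigraph is a vertex set together with a symmetric
  edge-multiplicity function. Only the values of \<open>emult\<close> on pairs of vertices matter.
\<close>

record 'a mgraph =
  verts :: "'a set"
  emult :: "'a \<Rightarrow> 'a \<Rightarrow> nat"

definition nbrs :: "'a mgraph \<Rightarrow> 'a \<Rightarrow> 'a set" where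
  "nbrs G v = {w \<in> verts G. emult G v w \<noteq> 0}"

definition degree :: "'a mgraph \<Rightarrow> 'a \<Rightarrow> nat" where
  "degree G v = (\<Sum>w\<in>nbrs G v. emult G v w)"

definition leaves :: "'a mgraph \<Rightarrow> 'a set" where
  "leaves G = {v \<in> verts G. \<exists>!w. w \<in> verts G \<and> w \<noteq> v \<and> emult G v w \<noteq> 0}"

definition connected_mgraph :: "'a mgraph \<Rightarrow> bool" where
  "connected_mgraph G \<longleftrightarrow>
     (\<forall>v\<in>verts G. \<forall>w\<in>verts G. (v, w) \<in> {(x, y). x \<in> verts G \<and> y \<in> nbrs G x}\<^sup>*)"

definition lf_multigraph :: "'a mgraph \<Rightarrow> bool" where
  "lf_multigraph G \<longleftrightarrow>
     (\<forall>v\<in>verts G. \<forall>w\<in>verts G. emult G v w = emult G w v) \<and>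
     (\<forall>v\<in>verts G. emult G v v = 0) \<and>
     connected_mgraph G \<and>
     (infinite (verts G) \<or> 3 \<le> card (verts G)) \<and>
     (\<forall>v\<in>verts G. finite (nbrs G v))"

text \<open>
  Local finiteness is implied by bounded degree, but has to be demanded separately because
  \<^const>\<open>degree\<close> is \<open>0\<close> at a vertex with infinitely many neighbours.
\<close>

definition multigraph :: "'a mgraph \<Rightarrow> bool" where
  "multigraph G \<longleftrightarrow> lf_multigraph G \<and> (\<exists>d. \<forall>v\<in>verts G. degree G v \<le> d)"

definition weak_harmonic_labeling :: "int set \<Rightarrow> 'a mgraph \<Rightarrow> ('a \<Rightarrow> int) \<Rightarrow> bool" where
  "weak_harmonic_labeling I G l \<longleftrightarrow>
     bij_betw l (verts G) I \<and>
     (\<forall>v \<in> verts G - leaves G.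
        real_of_int (l v) =
          (1 / real (degree G v)) * (\<Sum>w\<in>nbrs G v. real (emult G v w) * real_of_int (l w)))"

type_synonym 'a labeled_mgraph = "'a mgraph \<times> ('a \<Rightarrow> int)"

text \<open>The two vertex types may differ.\<close>

definition labeled_isomorphic :: "'a labeled_mgraph \<Rightarrow> 'b labeled_mgraph \<Rightarrow> bool" where
  "labeled_isomorphic X Y \<longleftrightarrow>
     (\<exists>f. bij_betw f (verts (fst X)) (verts (fst Y)) \<and>
          (\<forall>v\<in>verts (fst X). \<forall>w\<in>verts (fst X). emult (fst Y) (f v) (f w) = emult (fst X) v w) \<and>
          (\<forall>v\<in>verts (fst X). snd Y (f v) = snd X v))"

definition lf_labeled_mgraphs :: "int set \<Rightarrow> 'a labeled_mgraph set" where
  "lf_labeled_mgraphs I = {(G, l). lf_multigraph G \<and> weak_harmonic_labeling I G l}"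

definition labeled_mgraphs :: "int set \<Rightarrow> 'a labeled_mgraph set" where
  "labeled_mgraphs I = {(G, l). multigraph G \<and> weak_harmonic_labeling I G l}"

definition labeled_iso :: "int set \<Rightarrow> 'a labeled_mgraph rel" where
  "labeled_iso I =
     {(X, Y). X \<in> lf_labeled_mgraphs I \<and> Y \<in> lf_labeled_mgraphs I \<and> labeled_isomorphic X Y}"

text \<open>
  Isomorphism classes of pairs with vertices taken from the type \<open>'a\<close>: of bounded degree
  (\<open>MG\<close>), respectively merely locally finite (\<open>MG_lf\<close>). Bounded degree is an isomorphism
  invariant, so the classes in \<open>MG\<close> consist of multigraphs of bounded degree only.
\<close>

definition MG :: "int set \<Rightarrow> 'a labeled_mgraph set set" where
  "MG I = labeled_mgraphs I // labeled_iso I"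

definition MG_lf :: "int set \<Rightarrow> 'a labeled_mgraph set set" where
  "MG_lf I = lf_labeled_mgraphs I // labeled_iso I"

definition av :: "int multiset \<Rightarrow> real" where
  "av M = (1 / real (size M)) * (\<Sum>k\<in>set_mset M. real (count M k) * real_of_int k)"

text \<open>
  Averages are real numbers, elements of multisets are integers: \<open>pow_in x k M\<close> is the relation
  \<open>x\<^sup>k \<in> M\<close>, i.e. \<open>x\<close> is an element of \<open>M\<close> and its multiplicity is \<open>k\<close>.
\<close>

definition pow_in :: "real \<Rightarrow> nat \<Rightarrow> int multiset \<Rightarrow> bool" where
  "pow_in x k M \<longleftrightarrow> (\<exists>t. t \<in># M \<and> real_of_int t = x \<and> count M t = k)"

definition harmonic_multiset :: "int multiset \<Rightarrow> bool" where
  "harmonic_multiset M \<longleftrightarrow> M \<noteq> {#} \<and> av M \<in> real_of_int ` set_mset M"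

definition trivial_multiset :: "int multiset \<Rightarrow> bool" where
  "trivial_multiset M \<longleftrightarrow> card (set_mset M) = 1"

text \<open>
  The requirement \<open>pow_in (av B) 1 B\<close> fixes the multiplicity of the average. Changing that
  multiplicity affects neither \<open>av B\<close> nor the multigraph built from the collection, so without it
  the collections \<open>{{#0,1,2#}}\<close> and \<open>{{#0,1,1,2#}}\<close> would yield the same labeled multigraph.
\<close>

definition MH :: "int set \<Rightarrow> int multiset set set" where
  "MH I = {MA.
     (\<forall>B\<in>MA. harmonic_multiset B \<and> \<not> trivial_multiset B \<and> pow_in (av B) 1 B) \<and>
     (\<Union>D\<in>MA. set_mset D) = I \<and>
     (\<forall>B\<in>MA. \<forall>C\<in>MA. B \<noteq> C \<longrightarrow> av B \<noteq> av C) \<and>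
     (\<forall>B\<in>MA. \<forall>C\<in>MA. \<forall>t \<in> set_mset B \<inter> set_mset C.
        B \<noteq> C \<longrightarrow> (\<exists>D\<in>MA. av D = real_of_int t)) \<and>
     (\<forall>B\<in>MA. \<forall>C\<in>MA. \<forall>k. pow_in (av B) k C \<longrightarrow> pow_in (av C) k B) \<and>
     (\<forall>B\<in>MA. \<forall>C\<in>MA. \<exists>Bs. Bs \<noteq> [] \<and> set Bs \<subseteq> MA \<and> hd Bs = B \<and> last Bs = C \<and>
        (\<forall>j. Suc j < length Bs \<longrightarrow> av (Bs ! j) \<in> real_of_int ` set_mset (Bs ! Suc j)))}"

text \<open>
  A collection with multisets of unbounded size can yield a multigraph of unbounded degree (e.g.
  the multisets consisting of \<open>2j\<close> once, \<open>2j-1\<close> twice, \<open>2j-2\<close> with multiplicity \<open>j\<close> and \<open>2j+2\<close>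
  with multiplicity \<open>j+1\<close>, for \<open>j \<ge> 1\<close>), so the counterpart of \<^const>\<open>MG\<close> is the following
  subclass, whereas \<^const>\<open>MH\<close> itself is the counterpart of \<^const>\<open>MG_lf\<close>.
\<close>

definition MH_bounded :: "int set \<Rightarrow> int multiset set set" where
  "MH_bounded I = {MA \<in> MH I. \<exists>d. \<forall>B\<in>MA. size B \<le> d}"

definition ball_mset :: "'a mgraph \<Rightarrow> ('a \<Rightarrow> int) \<Rightarrow> 'a \<Rightarrow> int multiset" where
  "ball_mset G l v = {#l v#} + (\<Sum>w\<in>nbrs G v. replicate_mset (emult G v w) (l w))"

definition MA_of :: "'a labeled_mgraph \<Rightarrow> int multiset set" where
  "MA_of X = ball_mset (fst X) (snd X) ` (verts (fst X) - leaves (fst X))"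

definition joined :: "int multiset set \<Rightarrow> int \<Rightarrow> int \<Rightarrow> nat \<Rightarrow> bool" where
  "joined MA i j k \<longleftrightarrow>
     (\<exists>B\<in>MA. (real_of_int i = av B \<and> pow_in (real_of_int j) k B) \<or>
             (real_of_int j = av B \<and> pow_in (real_of_int i) k B))"

definition graph_of :: "int set \<Rightarrow> int multiset set \<Rightarrow> int mgraph" where
  "graph_of I MA =
     \<lparr>verts = I,
      emult = (\<lambda>i j. if i \<noteq> j \<and> (\<exists>k. joined MA i j k) then (THE k. joined MA i j k) else 0)\<rparr>"

definition labeling_of :: "int multiset set \<Rightarrow> int \<Rightarrow> int" where
  "labeling_of MA i = i"

text \<open>
  The two maps on the level of isomorphism classes. \<open>class_of_MA\<close> yields the class, within the
  vertex type \<open>'a\<close>, of the integer multigraph \<^const>\<open>graph_of\<close> with its labeling.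
\<close>

definition MA_of_class :: "'a labeled_mgraph set \<Rightarrow> int multiset set" where
  "MA_of_class c = the_elem (MA_of ` c)"

definition class_of_MA :: "int set \<Rightarrow> int multiset set \<Rightarrow> 'a labeled_mgraph set" where
  "class_of_MA I MA =
     {X \<in> lf_labeled_mgraphs I. labeled_isomorphic (graph_of I MA, labeling_of MA) X}"

definition mutually_inverse :: "'a set \<Rightarrow> 'b set \<Rightarrow> ('a \<Rightarrow> 'b) \<Rightarrow> ('b \<Rightarrow> 'a) \<Rightarrow> bool" where
  "mutually_inverse A B f g \<longleftrightarrow>
     (\<forall>x\<in>A. f x \<in> B) \<and> (\<forall>y\<in>B. g y \<in> A) \<and> (\<forall>x\<in>A. g (f x) = x) \<and> (\<forall>y\<in>B. f (g y) = y)"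

end

theory Submission
  imports Defs "HOL-Library.Countable"
begin

text \<open>
  A labeled multigraph can be recovered from its balls, because every edge has an end point that is
  not a leaf: two adjacent leaves would form a component of their own, whereas the multigraph is
  connected and has at least three vertices. The ball around that end point \<open>v\<close> records the edge,
  and \<open>v\<close> itself can be read off from its ball, since harmonicity at \<open>v\<close> says exactly that the
  average of the ball is \<open>l v\<close> (\<open>av_ball_iff\<close>). So the labeling is an isomorphism onto the integer
  multigraph built from the balls (\<open>isomorphic_graph_of_MA_of\<close>). Conditions (MP1) to (MP5) hold
  because a leaf lies in no two balls and because walks between vertices that are not leaves need
  not visit leaves (\<open>connected_without_leaves\<close>).

  Conversely, let a collection satisfy (MP1) to (MP5). By (MP2), a multiset of the collection is
  determined by its average, its centre, and by (MP4) two centres agree on how many edges join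
  them; as centres moreover have multiplicity one, the multiset with centre \<open>b\<close> is the ball around \<open>b\<close> in the integer multigraph
  (\<open>ball_center\<close>). A centre has neighbours on both sides, hence is not a leaf, while by (MP1) and
  (MP3) any other integer of the interval lies in exactly one multiset and thus is a leaf
  (\<open>inner_eq\<close>). Therefore the balls around the vertices that are not leaves give back the
  collection.

  Bounded degree corresponds to bounded size of the multisets, as a ball has one element more than
  the degree of its centre. It remains to pass to isomorphism classes over an infinite vertex type,
  which contains a copy of every integer multigraph.
\<close>

section \<open>Averages and balls\<close>

text \<open>
  Harmonicity is used in the form that the weighted deviations from the average cancel.
\<close>

lemma av_eq_iff:
  assumes "M \<noteq> {#}"
  shows "av M = x \<longleftrightarrow> (\<Sum>k\<in>set_mset M. real (count M k) * (real_of_int k - x)) = 0"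
proof -
  have pos: "real (size M) \<noteq> 0"
    using assms by (simp add: size_eq_0_iff_empty)
  have "(\<Sum>k\<in>set_mset M. real (count M k) * (real_of_int k - x))
      = (\<Sum>k\<in>set_mset M. real (count M k) * real_of_int k) - real (size M) * x"
    by (simp add: right_diff_distrib sum_subtractf sum_distrib_right size_multiset_overloaded_eq)
  then show ?thesis
    using pos by (auto simp: av_def field_simps)
qed

lemma average_strictly_between:
  assumes "harmonic_multiset M" "\<not> trivial_multiset M"
  obtains a b where "a \<in># M" "b \<in># M" "real_of_int a < av M" "av M < real_of_int b"
proof -
  have ne: "M \<noteq> {#}" and "av M \<in> real_of_int ` set_mset M"
    using assms(1) by (auto simp: harmonic_multiset_def)
  then obtain c where c: "c \<in># M" "av M = real_of_int c" by auto
  have sum0: "(\<Sum>k\<in>set_mset M. real (count M k) * (real_of_int k - av M)) = 0"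
    using av_eq_iff[OF ne, of "av M"] by simp
  obtain k where k: "k \<in># M" "k \<noteq> c"
  proof -
    have "set_mset M \<noteq> {c}" using assms(2) by (auto simp: trivial_multiset_def)
    then show ?thesis using that c(1) by blast
  qed
  then have "count M k \<noteq> 0" by (simp add: count_eq_zero_iff)
  have "\<exists>b\<in>#M. av M < real_of_int b"
  proof (rule ccontr)
    assume "\<not> ?thesis"
    then have le: "\<forall>b\<in>#M. real_of_int b \<le> av M" by (simp add: not_less)
    have "(\<Sum>k\<in>set_mset M. real (count M k) * (av M - real_of_int k)) = 0"
      using sum0 by (simp add: right_diff_distrib sum_subtractf)
    moreover have "0 \<le> real (count M t) * (av M - real_of_int t)" if "t \<in># M" for t
      using le that by simp
    ultimately have "\<forall>t\<in>#M. real (count M t) * (av M - real_of_int t) = 0"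
      using sum_nonneg_eq_0_iff[of "set_mset M" "\<lambda>t. real (count M t) * (av M - real_of_int t)"]
      by simp
    then have "real (count M k) * (av M - real_of_int k) = 0" using k(1) by blast
    then show False using k(2) c(2) \<open>count M k \<noteq> 0\<close> by simp
  qed
  moreover have "\<exists>a\<in>#M. real_of_int a < av M"
  proof (rule ccontr)
    assume "\<not> ?thesis"
    then have ge: "\<forall>a\<in>#M. av M \<le> real_of_int a" by (simp add: not_less)
    then have "0 \<le> real (count M t) * (real_of_int t - av M)" if "t \<in># M" for t
      using that by simp
    then have "\<forall>t\<in>#M. real (count M t) * (real_of_int t - av M) = 0"
      using sum0 sum_nonneg_eq_0_iff[of "set_mset M" "\<lambda>t. real (count M t) * (real_of_int t - av M)"]
      by simp
    then have "real (count M k) * (real_of_int k - av M) = 0" using k(1) by blast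
    then show False using k(2) c(2) \<open>count M k \<noteq> 0\<close> by simp
  qed
  ultimately show ?thesis using that by blast
qed

lemma pow_in_of_int: "pow_in (real_of_int t) k B \<longleftrightarrow> t \<in># B \<and> count B t = k"
  by (auto simp: pow_in_def)

lemma nbrs_verts: "w \<in> nbrs G v \<Longrightarrow> w \<in> verts G"
  by (simp add: nbrs_def)

lemma leaves_iff:
  "v \<in> leaves G \<longleftrightarrow> v \<in> verts G \<and> is_singleton {w \<in> verts G. w \<noteq> v \<and> emult G v w \<noteq> 0}"
  by (simp add: leaves_def is_singleton_iff_ex1)

lemma leaves_iff_single_nbr:
  assumes "emult G v v = 0"
  shows "v \<in> leaves G \<longleftrightarrow> v \<in> verts G \<and> (\<exists>w. nbrs G v = {w})"
proof -
  have "{w \<in> verts G. w \<noteq> v \<and> emult G v w \<noteq> 0} = nbrs G v"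
    using assms by (auto simp: nbrs_def)
  then show ?thesis by (simp add: leaves_iff is_singleton_def)
qed

lemma set_mset_ball:
  assumes "finite (nbrs G v)"
  shows "set_mset (ball_mset G l v) = l ` insert v (nbrs G v)"
proof -
  have "set_mset (\<Sum>w\<in>nbrs G v. replicate_mset (emult G v w) (l w)) = l ` nbrs G v"
    using assms by (auto simp: set_mset_sum nbrs_def in_replicate_mset)
  then show ?thesis by (simp add: ball_mset_def)
qed

lemma count_ball:
  assumes "finite (nbrs G v)" "inj_on l (verts G)" "v \<in> verts G" "u \<in> verts G"
  shows "count (ball_mset G l v) (l u) = emult G v u + (if u = v then 1 else 0)"
proof -
  have "count (\<Sum>w\<in>nbrs G v. replicate_mset (emult G v w) (l w)) (l u)
      = (\<Sum>w\<in>nbrs G v. if w = u then emult G v w else 0)"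
    unfolding count_sum
    by (rule sum.cong) (use assms in \<open>auto simp: nbrs_def inj_on_eq_iff\<close>)
  also have "\<dots> = emult G v u"
    using assms by (auto simp: nbrs_def)
  finally show ?thesis
    using assms by (auto simp: ball_mset_def inj_on_eq_iff)
qed

lemma size_ball: "size (ball_mset G l v) = Suc (degree G v)"
  by (simp add: ball_mset_def degree_def size_multiset_sum)

lemma degree_pos:
  assumes "finite (nbrs G v)" "nbrs G v \<noteq> {}"
  shows "degree G v > 0"
  unfolding degree_def using assms by (intro sum_pos) (auto simp: nbrs_def)

text \<open>
  Harmonicity of the ball as a multiset and of the labeling at its centre are the same condition:
  the centre contributes the deviation \<open>0\<close>, so that the deviations from \<open>l v\<close> over the ball and
  over the neighbours alone have the same sum.
\<close>

lemma av_ball_iff: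
  assumes "finite (nbrs G v)" "inj_on l (verts G)" "v \<in> verts G" "nbrs G v \<noteq> {}"
  shows "av (ball_mset G l v) = real_of_int (l v) \<longleftrightarrow>
    real_of_int (l v) =
      (1 / real (degree G v)) * (\<Sum>w\<in>nbrs G v. real (emult G v w) * real_of_int (l w))"
proof -
  let ?B = "ball_mset G l v" and ?dev = "\<lambda>u. real_of_int (l u) - real_of_int (l v)"
  have sub: "insert v (nbrs G v) \<subseteq> verts G" using assms(3) by (auto simp: nbrs_def)
  have "(\<Sum>k\<in>set_mset ?B. real (count ?B k) * (real_of_int k - real_of_int (l v)))
      = (\<Sum>u\<in>insert v (nbrs G v). real (count ?B (l u)) * ?dev u)"
    unfolding set_mset_ball[OF assms(1)]
    by (subst sum.reindex) (use inj_on_subset[OF assms(2) sub] in auto)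
  also have "\<dots> = (\<Sum>u\<in>insert v (nbrs G v). real (emult G v u) * ?dev u)"
  proof (rule sum.cong)
    fix u assume "u \<in> insert v (nbrs G v)"
    then have "u \<in> verts G" using sub by blast
    then show "real (count ?B (l u)) * ?dev u = real (emult G v u) * ?dev u"
      using count_ball[OF assms(1-3)] by (cases "u = v") auto
  qed simp
  also have "\<dots> = (\<Sum>u\<in>nbrs G v. real (emult G v u) * ?dev u)"
    using assms(1) by (cases "v \<in> nbrs G v") (auto simp: insert_absorb)
  also have "\<dots> = (\<Sum>w\<in>nbrs G v. real (emult G v w) * real_of_int (l w))
      - real (degree G v) * real_of_int (l v)"
    by (simp add: right_diff_distrib sum_subtractf sum_distrib_right degree_def)
  finally have "av ?B = real_of_int (l v) \<longleftrightarrow>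
      (\<Sum>w\<in>nbrs G v. real (emult G v w) * real_of_int (l w))
      - real (degree G v) * real_of_int (l v) = 0"
    by (subst av_eq_iff) (auto simp: ball_mset_def)
  then show ?thesis
    using degree_pos[OF assms(1,4)] by (auto simp: field_simps)
qed

section \<open>Transport along isomorphisms\<close>

locale mgraph_iso =
  fixes f :: "'a \<Rightarrow> 'b" and G :: "'a mgraph" and l :: "'a \<Rightarrow> int"
    and H :: "'b mgraph" and l' :: "'b \<Rightarrow> int"
  assumes bij: "bij_betw f (verts G) (verts H)"
    and emult: "\<lbrakk>v \<in> verts G; w \<in> verts G\<rbrakk> \<Longrightarrow> emult H (f v) (f w) = emult G v w"
    and label: "v \<in> verts G \<Longrightarrow> l' (f v) = l v"
begin

lemma inj: "inj_on f (verts G)" and image: "verts H = f ` verts G"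
  using bij by (auto simp: bij_betw_def)

lemma nbrs_image: "v \<in> verts G \<Longrightarrow> nbrs H (f v) = f ` nbrs G v"
  by (auto simp: nbrs_def image emult)

lemma sum_nbrs: "v \<in> verts G \<Longrightarrow> sum g (nbrs H (f v)) = (\<Sum>w\<in>nbrs G v. g (f w))"
  by (simp add: nbrs_image, subst sum.reindex)
    (auto intro: inj_on_subset[OF inj] simp: nbrs_def)

lemma degree_eq: "v \<in> verts G \<Longrightarrow> degree H (f v) = degree G v"
  by (auto simp: degree_def sum_nbrs emult dest: nbrs_verts intro!: sum.cong)

lemma leaf_iff: "v \<in> verts G \<Longrightarrow> f v \<in> leaves H \<longleftrightarrow> v \<in> leaves G"
proof -
  assume v: "v \<in> verts G"
  let ?N = "{w \<in> verts G. w \<noteq> v \<and> emult G v w \<noteq> 0}"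
  have "{w \<in> verts H. w \<noteq> f v \<and> emult H (f v) w \<noteq> 0} = f ` ?N"
    using v inj by (auto simp: image emult inj_on_eq_iff)
  moreover have "is_singleton (f ` ?N) \<longleftrightarrow> is_singleton ?N"
    using inj_on_subset[OF inj, of ?N] by (auto simp: is_singleton_altdef card_image)
  ultimately show ?thesis
    using v by (simp add: leaves_iff image)
qed

lemma leaves_image: "verts H - leaves H = f ` (verts G - leaves G)"
  using leaf_iff by (auto simp: image)

lemma ball_eq: "v \<in> verts G \<Longrightarrow> ball_mset H l' (f v) = ball_mset G l v"
  by (auto simp: ball_mset_def sum_nbrs emult label dest: nbrs_verts intro!: sum.cong)

lemma MA_of_eq: "MA_of (H, l') = MA_of (G, l)"
  by (auto simp: MA_of_def leaves_image image_image ball_eq)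

lemma connected:
  assumes "connected_mgraph G" shows "connected_mgraph H"
proof -
  have "(f v, f w) \<in> {(x, y). x \<in> verts H \<and> y \<in> nbrs H x}\<^sup>*"
    if "v \<in> verts G" "w \<in> verts G" for v w
  proof -
    have "(v, w) \<in> {(x, y). x \<in> verts G \<and> y \<in> nbrs G x}\<^sup>*"
      using assms that by (auto simp: connected_mgraph_def)
    then show ?thesis
    proof (induction rule: rtrancl_induct)
      case (step x y)
      then have "(f x, f y) \<in> {(x, y). x \<in> verts H \<and> y \<in> nbrs H x}"
        by (simp add: image nbrs_image)
      with step.IH show ?case by (rule rtrancl_into_rtrancl)
    qed simp
  qed
  then show ?thesis by (auto simp: connected_mgraph_def image)
qed

lemma lf_labeled:
  assumes "(G, l) \<in> lf_labeled_mgraphs I" shows "(H, l') \<in> lf_labeled_mgraphs I"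
proof -
  have lf: "lf_multigraph G" and wh: "weak_harmonic_labeling I G l"
    using assms by (auto simp: lf_labeled_mgraphs_def)
  have "lf_multigraph H"
    using lf connected inj
    by (auto simp: lf_multigraph_def image emult nbrs_image card_image dest: finite_imageD)
  moreover have "bij_betw l' (verts H) I"
  proof -
    have "bij_betw (l' \<circ> f) (verts G) I"
      using wh by (auto simp: weak_harmonic_labeling_def label cong: bij_betw_cong)
    then show ?thesis using bij_betw_comp_iff[OF bij] by blast
  qed
  moreover have "(\<Sum>w\<in>nbrs H (f v). real (emult H (f v) w) * real_of_int (l' w))
      = (\<Sum>w\<in>nbrs G v. real (emult G v w) * real_of_int (l w))" if "v \<in> verts G" for v
    using that by (auto simp: sum_nbrs emult label dest: nbrs_verts intro!: sum.cong)
  ultimately show ?thesis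
    using wh
    by (auto simp: lf_labeled_mgraphs_def weak_harmonic_labeling_def leaves_image degree_eq label)
qed

end

lemma labeled_isomorphic_iff:
  "labeled_isomorphic (G, l) (H, l') \<longleftrightarrow> (\<exists>f. mgraph_iso f G l H l')"
  by (auto simp: labeled_isomorphic_def mgraph_iso_def)

lemma labeled_isomorphic_refl: "labeled_isomorphic X X"
  unfolding labeled_isomorphic_def by (rule exI[of _ id]) auto

lemma labeled_isomorphic_sym:
  assumes "labeled_isomorphic X Y" shows "labeled_isomorphic Y X"
proof -
  obtain G l H l' where XY: "X = (G, l)" "Y = (H, l')" by fastforce
  then obtain f where "mgraph_iso f G l H l'"
    using assms by (auto simp: labeled_isomorphic_iff)
  then interpret mgraph_iso f G l H l' .
  have "mgraph_iso (inv_into (verts G) f) H l' G l"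
    by unfold_locales
      (use bij in \<open>auto simp: bij_betw_inv_into image inv_into_f_f[OF inj] emult label\<close>)
  then show ?thesis by (auto simp: XY labeled_isomorphic_iff)
qed

lemma labeled_isomorphic_trans:
  assumes "labeled_isomorphic X Y" "labeled_isomorphic Y Z" shows "labeled_isomorphic X Z"
proof -
  obtain G l H l' K l'' where XYZ: "X = (G, l)" "Y = (H, l')" "Z = (K, l'')" by (metis surj_pair)
  then obtain f g where "mgraph_iso f G l H l'" "mgraph_iso g H l' K l''"
    using assms by (auto simp: labeled_isomorphic_iff)
  then have "mgraph_iso (g \<circ> f) G l K l''"
    by (auto simp: mgraph_iso_def intro: bij_betw_trans dest: bij_betwE)
  then show ?thesis by (auto simp: XYZ labeled_isomorphic_iff)
qed

lemma lf_labeled_isomorphic: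
  assumes "labeled_isomorphic X Y" "X \<in> lf_labeled_mgraphs I"
  shows "Y \<in> lf_labeled_mgraphs I"
proof -
  obtain G l H l' where XY: "X = (G, l)" "Y = (H, l')" by fastforce
  then obtain f where "mgraph_iso f G l H l'"
    using assms(1) by (auto simp: labeled_isomorphic_iff)
  then show ?thesis using mgraph_iso.lf_labeled assms(2) XY by blast
qed

lemma MA_of_isomorphic: "labeled_isomorphic X Y \<Longrightarrow> MA_of X = MA_of Y"
  by (cases X; cases Y) (auto simp: labeled_isomorphic_iff dest: mgraph_iso.MA_of_eq)

text \<open>
  An infinite type contains a copy of the countable type of integers, onto which the vertices can be
  moved.
\<close>

lemma ex_isomorphic_copy:
  fixes G :: "int mgraph"
  assumes "infinite (UNIV :: 'a set)"
  obtains Y :: "'a labeled_mgraph" where "labeled_isomorphic (G, l) Y"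
proof -
  obtain h :: "nat \<Rightarrow> 'a" where "inj h"
    using infinite_countable_subset[OF assms] by auto
  then obtain g :: "int \<Rightarrow> 'a" where g: "inj g"
    using inj_compose[OF _ inj_to_nat] by blast
  let ?H = "\<lparr>verts = g ` verts G, emult = \<lambda>x y. emult G (inv g x) (inv g y)\<rparr>"
  have "mgraph_iso g G l ?H (l \<circ> inv g)"
    by unfold_locales (use g in \<open>auto simp: bij_betw_def intro: inj_on_subset\<close>)
  then show ?thesis using that labeled_isomorphic_iff by blast
qed

section \<open>From labeled multigraphs to collections\<close>

text \<open>
  The sequences of (MP5) are walks, which allows connectedness to be translated in both directions
  by induction over reachability.
\<close>

lemma rtrancl_iff_chain:
  assumes "x \<in> S"
  shows "(x, y) \<in> {(a, b). a \<in> S \<and> b \<in> S \<and> P a b}\<^sup>* \<longleftrightarrow>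
    (\<exists>xs. xs \<noteq> [] \<and> set xs \<subseteq> S \<and> hd xs = x \<and> last xs = y \<and>
      (\<forall>j. Suc j < length xs \<longrightarrow> P (xs ! j) (xs ! Suc j)))"
    (is "(x, y) \<in> ?R\<^sup>* \<longleftrightarrow> (\<exists>xs. ?chain x xs)")
proof
  assume "(x, y) \<in> ?R\<^sup>*"
  then show "\<exists>xs. ?chain x xs"
    using assms
  proof (induction rule: converse_rtrancl_induct)
    case base
    then show ?case by (intro exI[of _ "[y]"]) auto
  next
    case (step x z)
    then obtain xs where "?chain z xs" by blast
    with step have "?chain x (x # xs)"
      by (auto simp: nth_Cons hd_conv_nth split: nat.split)
    then show ?case by blast
  qed
next
  assume "\<exists>xs. ?chain x xs"
  then obtain xs where "?chain x xs" by blast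
  then show "(x, y) \<in> ?R\<^sup>*"
  proof (induction xs arbitrary: x)
    case Nil
    then show ?case by simp
  next
    case (Cons a xs)
    show ?case
    proof (cases xs)
      case Nil
      with Cons show ?thesis by auto
    next
      case (Cons b ys)
      have steps: "P ((a # xs) ! j) ((a # xs) ! Suc j)" if "Suc j < length (a # xs)" for j
        using Cons.prems that by blast
      have "?chain b xs"
        using Cons.prems Cons steps[of "Suc _"] by auto
      then have "(b, y) \<in> ?R\<^sup>*" by (rule Cons.IH)
      moreover have "(a, b) \<in> ?R"
        using Cons.prems Cons steps[of 0] by auto
      ultimately show ?thesis
        using Cons.prems by (auto intro: converse_rtrancl_into_rtrancl)
    qed
  qed
qed

locale harmonic_mgraph =
  fixes I :: "int set" and G :: "'a mgraph" and l :: "'a \<Rightarrow> int"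
  assumes lf: "(G, l) \<in> lf_labeled_mgraphs I"
begin

lemma lf_graph: "lf_multigraph G" and labeling: "weak_harmonic_labeling I G l"
  using lf by (simp_all add: lf_labeled_mgraphs_def)

lemma
  shows inj: "inj_on l (verts G)" and image: "l ` verts G = I"
    and sym: "\<lbrakk>v \<in> verts G; w \<in> verts G\<rbrakk> \<Longrightarrow> emult G v w = emult G w v"
    and loopless: "v \<in> verts G \<Longrightarrow> emult G v v = 0"
    and finite_nbrs: "v \<in> verts G \<Longrightarrow> finite (nbrs G v)"
    and connected: "connected_mgraph G"
    and large: "infinite (verts G) \<or> 3 \<le> card (verts G)"
  using lf_graph labeling
  by (simp_all add: lf_multigraph_def weak_harmonic_labeling_def bij_betw_def)

lemma leaf_iff: "v \<in> verts G \<Longrightarrow> v \<in> leaves G \<longleftrightarrow> (\<exists>w. nbrs G v = {w})"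
  by (simp add: leaves_iff_single_nbr loopless)

lemma nbrs_sym: "\<lbrakk>v \<in> verts G; w \<in> nbrs G v\<rbrakk> \<Longrightarrow> v \<in> nbrs G w"
  using sym by (auto simp: nbrs_def)

lemma nbrs_closed_set:
  assumes "v \<in> S" "v \<in> verts G" "\<And>x. x \<in> S \<Longrightarrow> nbrs G x \<subseteq> S"
  shows "verts G \<subseteq> S"
proof
  fix w assume "w \<in> verts G"
  then have "(v, w) \<in> {(x, y). x \<in> verts G \<and> y \<in> nbrs G x}\<^sup>*"
    using connected assms(2) by (auto simp: connected_mgraph_def)
  then show "w \<in> S"
    by (induction rule: rtrancl_induct) (use assms in auto)
qed

text \<open>
  The form in which connectedness and the bound of three on the number of vertices are used: they
  exclude isolated vertices and adjacent pairs of leaves.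
\<close>

lemma no_small_closed_set:
  assumes "v \<in> S" "v \<in> verts G" "\<And>x. x \<in> S \<Longrightarrow> nbrs G x \<subseteq> S" "finite S" "card S \<le> 2"
  shows False
proof -
  have sub: "verts G \<subseteq> S" using nbrs_closed_set[of v S] assms(1-3) by simp
  then have "finite (verts G)" "card (verts G) \<le> 2"
    using finite_subset[OF sub assms(4)] card_mono[OF assms(4) sub] assms(5) by simp_all
  then show False using large by simp
qed

lemma nbrs_nonempty: "v \<in> verts G \<Longrightarrow> nbrs G v \<noteq> {}"
  using no_small_closed_set[of v "{v}"] by auto

lemma nbr_of_leaf:
  assumes "v \<in> leaves G" "w \<in> nbrs G v"
  shows "nbrs G v = {w}" "w \<in> verts G - leaves G"
proof -
  have v: "v \<in> verts G" using assms(1) by (auto simp: leaves_def)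
  then show Nv: "nbrs G v = {w}" using assms leaf_iff by auto
  have w: "w \<in> verts G" using assms(2) by (auto simp: nbrs_def)
  have "w \<notin> leaves G"
  proof
    assume "w \<in> leaves G"
    then have "nbrs G w = {v}" using leaf_iff[OF w] nbrs_sym[OF v assms(2)] by auto
    with Nv have "nbrs G x \<subseteq> {v, w}" if "x \<in> {v, w}" for x using that by auto
    moreover have "card {v, w} \<le> 2" by (cases "v = w") auto
    ultimately show False using no_small_closed_set[of v "{v, w}"] v by blast
  qed
  with w show "w \<in> verts G - leaves G" by blast
qed

lemma av_ball:
  assumes "v \<in> verts G - leaves G"
  shows "av (ball_mset G l v) = real_of_int (l v)"
proof -
  have "v \<in> verts G" using assms by simp
  then show ?thesis
    using labeling assms av_ball_iff[OF finite_nbrs inj _ nbrs_nonempty, of v]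
    unfolding weak_harmonic_labeling_def by blast
qed

lemma set_ball: "v \<in> verts G \<Longrightarrow> set_mset (ball_mset G l v) = l ` insert v (nbrs G v)"
  by (simp add: set_mset_ball finite_nbrs)

lemma label_in_ball_iff:
  "\<lbrakk>v \<in> verts G; u \<in> verts G\<rbrakk> \<Longrightarrow> l u \<in># ball_mset G l v \<longleftrightarrow> u = v \<or> u \<in> nbrs G v"
  using inj_on_image_mem_iff[OF inj, of u "insert v (nbrs G v)"]
  by (auto simp: set_ball dest: nbrs_verts)

lemma pow_in_ball_iff:
  assumes "v \<in> verts G" "u \<in> verts G"
  shows "pow_in (real_of_int (l u)) k (ball_mset G l v) \<longleftrightarrow>
    k \<noteq> 0 \<and> k = emult G v u + (if u = v then 1 else 0)"
proof -
  have "pow_in (real_of_int (l u)) k (ball_mset G l v) \<longleftrightarrow>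
      k \<noteq> 0 \<and> k = count (ball_mset G l v) (l u)"
    unfolding pow_in_of_int by (metis count_eq_zero_iff)
  then show ?thesis using count_ball[OF finite_nbrs inj] assms by simp
qed

text \<open>
  A walk can only enter a leaf from its unique neighbour and has to leave it the same way, so
  detours through leaves may be cut out.
\<close>

lemma connected_without_leaves:
  assumes "v \<in> verts G - leaves G" "w \<in> verts G - leaves G"
  shows "(v, w) \<in> {(x, y). x \<in> verts G - leaves G \<and> y \<in> verts G - leaves G \<and> y \<in> nbrs G x}\<^sup>*"
    (is "_ \<in> ?R\<^sup>*")
proof -
  \<comment> \<open>A leaf belongs to the set once its neighbour can be reached; this makes the set closed.\<close>
  let ?S = "{w. w \<in> verts G \<and> (if w \<in> leaves G then (\<forall>u\<in>nbrs G w. (v, u) \<in> ?R\<^sup>*) else (v, w) \<in> ?R\<^sup>*)}"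
  have "nbrs G x \<subseteq> ?S" if x: "x \<in> ?S" for x
  proof
    fix y assume y: "y \<in> nbrs G x"
    have V: "x \<in> verts G" "y \<in> verts G" using x y by (auto simp: nbrs_def)
    show "y \<in> ?S"
    proof (cases "x \<in> leaves G")
      case True
      with x y nbr_of_leaf(2)[OF True y] show ?thesis by auto
    next
      case False
      with x have vx: "(v, x) \<in> ?R\<^sup>*" by auto
      show ?thesis
      proof (cases "y \<in> leaves G")
        case True
        then show ?thesis using nbr_of_leaf(1)[OF True nbrs_sym[OF V(1) y]] vx V by auto
      next
        case notleaf: False
        then have "(x, y) \<in> ?R" using False V y by auto
        then show ?thesis using vx V notleaf by (auto intro: rtrancl_into_rtrancl)
      qed
    qed
  qed
  moreover have "v \<in> ?S" using assms(1) by auto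
  ultimately have "verts G \<subseteq> ?S" using nbrs_closed_set[of v ?S] assms(1) by blast
  then show ?thesis using assms(2) by auto
qed

abbreviation "inner \<equiv> verts G - leaves G"

lemma MA_of_eq: "MA_of (G, l) = ball_mset G l ` inner"
  by (simp add: MA_of_def)

lemma chain_of_balls:
  assumes "v \<in> inner" "w \<in> inner"
  shows "(ball_mset G l v, ball_mset G l w) \<in> {(B, C). B \<in> MA_of (G, l) \<and> C \<in> MA_of (G, l) \<and>
    av B \<in> real_of_int ` set_mset C}\<^sup>*"
  using connected_without_leaves[OF assms]
proof (induction rule: rtrancl_induct)
  case base
  then show ?case by simp
next
  case (step x y)
  then have "l x \<in># ball_mset G l y"
    using nbrs_sym by (auto simp: label_in_ball_iff)
  then have "av (ball_mset G l x) \<in> real_of_int ` set_mset (ball_mset G l y)"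
    using step av_ball by auto
  with step show ?case
    by (auto simp: MA_of_eq intro!: rtrancl_into_rtrancl[of "ball_mset G l v" "ball_mset G l x"])
qed

lemma ball_harmonic:
  assumes "v \<in> inner"
  shows "harmonic_multiset (ball_mset G l v)" "\<not> trivial_multiset (ball_mset G l v)"
    "pow_in (av (ball_mset G l v)) 1 (ball_mset G l v)"
proof -
  have v: "v \<in> verts G" using assms by auto
  show "harmonic_multiset (ball_mset G l v)"
    unfolding harmonic_multiset_def av_ball[OF assms] using set_ball[OF v]
    by (auto simp: ball_mset_def)
  show "pow_in (av (ball_mset G l v)) 1 (ball_mset G l v)"
    using v by (simp add: av_ball[OF assms] pow_in_ball_iff loopless)
  show "\<not> trivial_multiset (ball_mset G l v)"
  proof
    assume "trivial_multiset (ball_mset G l v)"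
    then obtain t where t: "set_mset (ball_mset G l v) = {t}"
      by (auto simp: trivial_multiset_def card_1_singleton_iff)
    obtain w where w: "w \<in> nbrs G v" using nbrs_nonempty[OF v] by auto
    with t have "l w = l v" by (auto simp: set_ball[OF v])
    then have "w = v" using inj v w by (auto simp: nbrs_def inj_on_eq_iff)
    then show False using w v loopless by (auto simp: nbrs_def)
  qed
qed

lemma MA_of_cover: "(\<Union>D\<in>MA_of (G, l). set_mset D) = I"
proof
  show "(\<Union>D\<in>MA_of (G, l). set_mset D) \<subseteq> I"
    by (auto simp: MA_of_eq set_ball nbrs_def simp flip: image)
next
  show "I \<subseteq> (\<Union>D\<in>MA_of (G, l). set_mset D)"
  proof
    fix i assume "i \<in> I"
    then obtain v where v: "v \<in> verts G" "i = l v" using image by auto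
    obtain w where w: "w \<in> nbrs G v" using nbrs_nonempty v by blast
    have "\<exists>u\<in>inner. v = u \<or> v \<in> nbrs G u"
      using nbr_of_leaf(2)[OF _ w] nbrs_sym[OF v(1) w] v by blast
    then obtain u where "u \<in> inner" "i \<in># ball_mset G l u"
      using label_in_ball_iff v by auto
    then show "i \<in> (\<Union>D\<in>MA_of (G, l). set_mset D)" by (auto simp: MA_of_eq)
  qed
qed

lemma MA_of_in_MH: "MA_of (G, l) \<in> MH I"
proof -
  let ?MA = "MA_of (G, l)"
  have "\<exists>D\<in>?MA. av D = real_of_int t"
    if BC: "B \<in> ?MA" "C \<in> ?MA" "t \<in> set_mset B \<inter> set_mset C" "B \<noteq> C" for B C t
  proof -
    obtain v w where v: "v \<in> inner" "B = ball_mset G l v" and w: "w \<in> inner" "C = ball_mset G l w"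
      using BC(1,2) by (auto simp: MA_of_eq)
    obtain u where u: "u \<in> verts G" "t = l u"
      using BC(3) v by (auto simp: set_ball nbrs_def)
    have u': "u = v \<or> u \<in> nbrs G v" "u = w \<or> u \<in> nbrs G w"
      using BC(3) u v w label_in_ball_iff by auto
    \<comment> \<open>A leaf would have both \<open>v\<close> and \<open>w\<close> as neighbours.\<close>
    have "u \<notin> leaves G"
    proof
      assume leaf: "u \<in> leaves G"
      then have "v \<in> nbrs G u" "w \<in> nbrs G u" using u' v w nbrs_sym by auto
      then have "v = w" using nbr_of_leaf(1)[OF leaf] by blast
      then show False using BC(4) v w by simp
    qed
    then show ?thesis using u av_ball[of u] by (auto simp: MA_of_eq)
  qed
  moreover have "pow_in (av C) k B"
    if BC: "B \<in> ?MA" "C \<in> ?MA" "pow_in (av B) k C" for B C k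
  proof -
    obtain v w where "v \<in> inner" "B = ball_mset G l v" "w \<in> inner" "C = ball_mset G l w"
      using BC(1,2) by (auto simp: MA_of_eq)
    then show ?thesis using BC(3) sym by (auto simp: av_ball pow_in_ball_iff)
  qed
  moreover have "av B \<noteq> av C" if "B \<in> ?MA" "C \<in> ?MA" "B \<noteq> C" for B C
    using that inj by (auto simp: MA_of_eq av_ball inj_on_eq_iff)
  moreover have "\<exists>Bs. Bs \<noteq> [] \<and> set Bs \<subseteq> ?MA \<and> hd Bs = B \<and> last Bs = C \<and>
      (\<forall>j. Suc j < length Bs \<longrightarrow> av (Bs ! j) \<in> real_of_int ` set_mset (Bs ! Suc j))"
    if "B \<in> ?MA" "C \<in> ?MA" for B C
    using that chain_of_balls
    by (subst rtrancl_iff_chain[symmetric]) (auto simp: MA_of_eq)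
  ultimately show ?thesis
    unfolding MH_def using ball_harmonic MA_of_cover by (auto simp: MA_of_eq)
qed

text \<open>The degree of a leaf is at most that of its neighbour, which is not a leaf.\<close>

lemma bounded_degree_iff:
  "(\<exists>d. \<forall>v\<in>verts G. degree G v \<le> d) \<longleftrightarrow> (\<exists>d. \<forall>B\<in>MA_of (G, l). size B \<le> d)"
proof
  assume "\<exists>d. \<forall>v\<in>verts G. degree G v \<le> d"
  then show "\<exists>d. \<forall>B\<in>MA_of (G, l). size B \<le> d"
    by (fastforce simp: MA_of_eq size_ball)
next
  assume "\<exists>d. \<forall>B\<in>MA_of (G, l). size B \<le> d"
  then obtain d where d: "Suc (degree G v) \<le> d" if "v \<in> inner" for v
    by (auto simp: MA_of_eq size_ball)
  have "degree G v \<le> d" if v: "v \<in> verts G" for v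
  proof (cases "v \<in> leaves G")
    case False
    then show ?thesis using d[of v] v by auto
  next
    case True
    obtain w where w: "w \<in> nbrs G v" using nbrs_nonempty[OF v] by auto
    note wv = nbr_of_leaf[OF True w]
    have "degree G v = emult G w v"
      using wv v sym by (simp add: degree_def)
    also have "\<dots> \<le> degree G w"
      unfolding degree_def using wv v nbrs_sym[OF v w] finite_nbrs
      by (intro member_le_sum) auto
    also have "\<dots> \<le> d" using d[OF wv(2)] by simp
    finally show ?thesis .
  qed
  then show "\<exists>d. \<forall>v\<in>verts G. degree G v \<le> d" by blast
qed

end

section \<open>From collections to labeled multigraphs\<close>

text \<open>
  For a harmonic multiset the average is an integer and the floor merely changes its type.
\<close>

definition center :: "int multiset \<Rightarrow> int" where
  "center B = \<lfloor>av B\<rfloor>"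

locale harmonic_collection =
  fixes I :: "int set" and MA :: "int multiset set"
  assumes MH: "MA \<in> MH I"
begin

lemma harmonic: "B \<in> MA \<Longrightarrow> harmonic_multiset B" "B \<in> MA \<Longrightarrow> \<not> trivial_multiset B"
  using MH by (auto simp: MH_def)

lemma av_center: "B \<in> MA \<Longrightarrow> av B = real_of_int (center B)"
  using harmonic(1)[of B] by (auto simp: harmonic_multiset_def center_def)

lemma count_center: "B \<in> MA \<Longrightarrow> count B (center B) = 1"
  and center_in: "B \<in> MA \<Longrightarrow> center B \<in># B"
  using MH av_center[of B] by (auto simp: MH_def pow_in_of_int)

lemma cover: "(\<Union>D\<in>MA. set_mset D) = I"
  using MH by (auto simp: MH_def)

lemma center_inj: "inj_on center MA"
proof (rule inj_onI)
  fix B C assume BC: "B \<in> MA" "C \<in> MA" "center B = center C"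
  then have "av B = av C" by (simp add: av_center)
  then show "B = C" using MH BC(1,2) unfolding MH_def by blast
qed

lemma shared_is_center:
  assumes "B \<in> MA" "C \<in> MA" "t \<in># B" "t \<in># C" "B \<noteq> C"
  shows "t \<in> center ` MA"
proof -
  have "\<exists>D\<in>MA. av D = real_of_int t" using MH assms unfolding MH_def by blast
  then show ?thesis using av_center by auto
qed

text \<open>
  (MP4) is an implication for positive multiplicities; applied in both directions it gives an
  equation that also holds when the multiplicity is \<open>0\<close>.
\<close>

lemma count_center_sym:
  assumes "B \<in> MA" "C \<in> MA"
  shows "count C (center B) = count B (center C)"
proof -
  have *: "count B (center C) = count C (center B)"
    if "B \<in> MA" "C \<in> MA" "center B \<in># C" for B C
  proof -
    have "pow_in (av B) (count C (center B)) C"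
      using that by (simp add: av_center pow_in_of_int)
    then have "pow_in (av C) (count C (center B)) B" using MH that(1,2) unfolding MH_def by blast
    then show ?thesis using that by (simp add: av_center pow_in_of_int)
  qed
  then show ?thesis
    using *[of B C] *[of C B] assms by (metis count_eq_zero_iff)
qed

lemma chain:
  assumes "B \<in> MA" "C \<in> MA"
  shows "(B, C) \<in> {(B, C). B \<in> MA \<and> C \<in> MA \<and> center B \<in># C}\<^sup>*"
proof -
  have "(B, C) \<in> {(B, C). B \<in> MA \<and> C \<in> MA \<and> av B \<in> real_of_int ` set_mset C}\<^sup>*"
    using MH assms unfolding rtrancl_iff_chain[OF assms(1)] MH_def by blast
  then show ?thesis
    by (rule rtrancl_mono[THEN subsetD, rotated]) (auto simp: av_center)
qed

abbreviation "G \<equiv> graph_of I MA"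

lemma joined_sym: "joined MA i j k \<longleftrightarrow> joined MA j i k"
  by (auto simp: joined_def)

text \<open>
  A pair of centres is joined by each of its two multisets; they agree on the number of edges by
  the symmetry of multiplicities.
\<close>

lemma joined_center:
  assumes "B \<in> MA"
  shows "joined MA (center B) j k \<longleftrightarrow> j \<in># B \<and> count B j = k"
proof
  assume "joined MA (center B) j k"
  then obtain C where C: "C \<in> MA" and
    "center B = center C \<and> j \<in># C \<and> count C j = k \<or>
     j = center C \<and> center B \<in># C \<and> count C (center B) = k"
    by (auto simp: joined_def av_center pow_in_of_int)
  then have "B = C \<and> j \<in># C \<and> count C j = k \<or>
      j = center C \<and> center B \<in># C \<and> count C (center B) = k"
    using assms center_inj by (auto simp: inj_on_eq_iff)
  moreover have "center B \<in># C \<longleftrightarrow> center C \<in># B"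
    using count_center_sym[OF assms C] by (metis count_eq_zero_iff)
  ultimately show "j \<in># B \<and> count B j = k"
    using count_center_sym[OF assms C] by auto
next
  assume "j \<in># B \<and> count B j = k"
  then show "joined MA (center B) j k"
    using assms by (auto simp: joined_def av_center pow_in_of_int)
qed

lemma joined_imp_center: "joined MA i j k \<Longrightarrow> i \<in> center ` MA \<or> j \<in> center ` MA"
  by (auto simp: joined_def av_center)

lemma joined_unique: "\<lbrakk>joined MA i j k; joined MA i j k'\<rbrakk> \<Longrightarrow> k = k'"
  using joined_imp_center[of i j k] joined_center joined_sym by auto

lemma emult_iff_joined:
  assumes "i \<noteq> j" "k \<ge> 1"
  shows "emult G i j = k \<longleftrightarrow> joined MA i j k"
proof -
  have *: "emult G i j = k" if "joined MA i j k" for k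
    using that assms(1) joined_unique by (auto simp: graph_of_def intro!: the_equality)
  show ?thesis
  proof
    assume "emult G i j = k"
    then obtain k' where "joined MA i j k'"
      using assms(2) by (auto simp: graph_of_def split: if_splits)
    then show "joined MA i j k" using * \<open>emult G i j = k\<close> by metis
  qed (rule *)
qed

lemma emult_sym: "emult G i j = emult G j i"
proof -
  have "joined MA j i = joined MA i j" by (simp add: fun_eq_iff joined_sym[of j i])
  then show ?thesis by (auto simp: graph_of_def)
qed

lemma emult_self: "emult G i i = 0"
  by (simp add: graph_of_def)

lemma verts: "verts G = I"
  by (simp add: graph_of_def)

lemma emult_center:
  assumes "B \<in> MA" "j \<noteq> center B"
  shows "emult G (center B) j = count B j"
proof (cases "j \<in># B")
  case True
  then show ?thesis
    using assms joined_center[OF assms(1)] by (subst emult_iff_joined) auto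
next
  case False
  then have "\<not> joined MA (center B) j k" for k using joined_center[OF assms(1)] by auto
  then show ?thesis using False by (auto simp: graph_of_def not_in_iff)
qed

lemma in_I: "\<lbrakk>B \<in> MA; t \<in># B\<rbrakk> \<Longrightarrow> t \<in> I"
  using cover by blast

lemma nbrs_center:
  assumes "B \<in> MA"
  shows "nbrs G (center B) = set_mset B - {center B}"
proof -
  have "j \<in> nbrs G (center B) \<longleftrightarrow> j \<in># B \<and> j \<noteq> center B" for j
    using in_I[OF assms, of j] emult_self emult_center[OF assms, of j]
    by (cases "j = center B") (auto simp: nbrs_def verts)
  then show ?thesis by blast
qed

text \<open>
  An integer that is no centre cannot be shared by two multisets, by (MP3), and so is adjacent only
  to the centre of the multiset that contains it.
\<close>

lemma nbrs_not_center:
  assumes "i \<in> I" "i \<notin> center ` MA"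
  obtains B where "B \<in> MA" "i \<in># B" "nbrs G i = {center B}"
proof -
  obtain B where B: "B \<in> MA" "i \<in># B" using assms(1) cover by auto
  have "i \<noteq> center B" using B(1) assms(2) by blast
  then have "emult G i (center B) = count B i"
    using emult_center[OF B(1)] emult_sym[of i "center B"] by simp
  then have cB: "center B \<in> nbrs G i"
    using B in_I[OF B(1) center_in[OF B(1)]] by (simp add: nbrs_def verts)
  have "nbrs G i = {center B}"
  proof
    show "{center B} \<subseteq> nbrs G i" using cB by blast
  next
    show "nbrs G i \<subseteq> {center B}"
    proof
      fix j assume "j \<in> nbrs G i"
      then have nz: "emult G i j \<noteq> 0" and "i \<noteq> j" by (auto simp: nbrs_def emult_self)
      then have "joined MA i j (emult G i j)" using emult_iff_joined[of i j "emult G i j"] by simp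
      then obtain C where C: "C \<in> MA" "j = center C"
        using joined_imp_center assms(2) by blast
      have "emult G i j = count C i"
        using emult_center[OF C(1), of i] emult_sym[of i j] C(2) \<open>i \<noteq> j\<close> by simp
      then have "i \<in># C" using nz by (simp add: not_in_iff)
      then have "B = C" using shared_is_center[OF B(1) C(1) B(2)] assms(2) by blast
      then show "j \<in> {center B}" using C by simp
    qed
  qed
  then show ?thesis using that B by blast
qed

text \<open>Non-trivial harmonic multisets have elements on either side of their average.\<close>

lemma center_two_nbrs:
  assumes "B \<in> MA"
  obtains a b where "a \<in> nbrs G (center B)" "b \<in> nbrs G (center B)" "a \<noteq> b"
proof -
  obtain a b where "a \<in># B" "b \<in># B" "real_of_int a < av B" "av B < real_of_int b"
    using average_strictly_between[OF harmonic[OF assms]] .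
  then have "a \<in> nbrs G (center B)" "b \<in> nbrs G (center B)" "a \<noteq> b"
    by (simp_all add: nbrs_center[OF assms] av_center[OF assms])
  then show ?thesis by (rule that)
qed

lemma inner_eq: "verts G - leaves G = center ` MA"
proof -
  have leaf_iff: "i \<in> leaves G \<longleftrightarrow> i \<in> I \<and> (\<exists>w. nbrs G i = {w})" for i
    using leaves_iff_single_nbr[OF emult_self] by (simp add: verts)
  have "center B \<notin> leaves G" if B: "B \<in> MA" for B
  proof -
    obtain a b where "a \<in> nbrs G (center B)" "b \<in> nbrs G (center B)" "a \<noteq> b"
      using center_two_nbrs[OF B] .
    then show ?thesis unfolding leaf_iff by auto
  qed
  moreover have "i \<in> leaves G" if i: "i \<in> I" "i \<notin> center ` MA" for i
  proof -
    obtain B where "nbrs G i = {center B}" using nbrs_not_center[OF i] .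
    then show ?thesis unfolding leaf_iff using i(1) by blast
  qed
  moreover have "center B \<in> I" if "B \<in> MA" for B
    using in_I[OF that center_in[OF that]] .
  ultimately show ?thesis
    unfolding verts by blast
qed

lemma finite_nbrs:
  assumes "i \<in> I" shows "finite (nbrs G i)"
proof (cases "i \<in> center ` MA")
  case True
  then show ?thesis by (auto simp: nbrs_center)
next
  case False
  obtain B where "nbrs G i = {center B}" using nbrs_not_center[OF assms False] .
  then show ?thesis by simp
qed

lemma inj_labeling: "inj_on (labeling_of MA) (verts G)"
  by (simp add: labeling_of_def inj_on_def)

lemma ball_center:
  assumes "B \<in> MA"
  shows "ball_mset G (labeling_of MA) (center B) = B"
proof (rule multiset_eqI)
  fix j
  have c: "center B \<in> I" using in_I center_in assms by blast
  show "count (ball_mset G (labeling_of MA) (center B)) j = count B j"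
  proof (cases "j \<in> I")
    case True
    then show ?thesis
      using count_ball[OF finite_nbrs[OF c] inj_labeling, of j] c assms
      by (cases "j = center B")
        (simp_all add: labeling_of_def verts emult_self emult_center count_center)
  next
    case False
    then have "j \<notin># ball_mset G (labeling_of MA) (center B)"
      using c set_mset_ball[OF finite_nbrs[OF c]] by (auto simp: labeling_of_def nbrs_def verts)
    then show ?thesis using False in_I[OF assms] by (metis not_in_iff)
  qed
qed

lemma MA_of_graph: "MA_of (G, labeling_of MA) = MA"
  by (auto simp: MA_of_def inner_eq image_image ball_center)

lemma connected: "connected_mgraph G"
proof -
  let ?R = "{(x, y). x \<in> verts G \<and> y \<in> nbrs G x}"
  have sym: "sym (?R\<^sup>*)"
    by (rule sym_rtrancl) (auto simp: sym_def nbrs_def emult_sym)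
  \<comment> \<open>Consecutive multisets of a chain may coincide, since a multiset contains its own centre.\<close>
  have centers: "(center B, center C) \<in> ?R\<^sup>*" if "B \<in> MA" "C \<in> MA" for B C
    using chain[OF that]
  proof (induction rule: rtrancl_induct)
    case base
    then show ?case by simp
  next
    case (step C D)
    then have "center C = center D \<or> center C \<in> nbrs G (center D)"
      using nbrs_center by auto
    then have "(center D, center C) \<in> ?R\<^sup>*"
      using step in_I center_in by (auto simp: verts)
    then show ?case using step symD[OF sym] by (meson rtrancl_trans)
  qed
  have to_center: "\<exists>B\<in>MA. (i, center B) \<in> ?R\<^sup>*" if i: "i \<in> I" for i
  proof (cases "i \<in> center ` MA")
    case False
    obtain B where "B \<in> MA" "nbrs G i = {center B}" using nbrs_not_center[OF i False] .
    then show ?thesis using i by (intro bexI[of _ B]) (auto simp: verts)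
  qed auto
  have "(i, j) \<in> ?R\<^sup>*" if ij: "i \<in> I" "j \<in> I" for i j
  proof -
    obtain B C where "B \<in> MA" "(i, center B) \<in> ?R\<^sup>*" "C \<in> MA" "(j, center C) \<in> ?R\<^sup>*"
      using to_center[OF ij(1)] to_center[OF ij(2)] by blast
    then show ?thesis
      using centers[of B C] symD[OF sym, of j "center C"] by (meson rtrancl_trans)
  qed
  then show ?thesis
    unfolding connected_mgraph_def by (simp add: verts)
qed

lemma graph_in_lf:
  assumes "I \<noteq> {}"
  shows "(G, labeling_of MA) \<in> lf_labeled_mgraphs I"
proof -
  have "infinite I \<or> 3 \<le> card I"
  proof (cases "finite I")
    case fin: True
    obtain B where B: "B \<in> MA" using assms cover by auto
    obtain a b where "a \<in># B" "b \<in># B" "real_of_int a < av B" "av B < real_of_int b"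
      using average_strictly_between[OF harmonic[OF B]] .
    then have "a \<in># B" "b \<in># B" "a < center B" "center B < b"
      by (simp_all add: av_center[OF B])
    then have "{a, center B, b} \<subseteq> I" "card {a, center B, b} = 3"
      using in_I[OF B] center_in[OF B] by auto
    then show ?thesis using card_mono[OF fin] by metis
  qed simp
  then have "lf_multigraph G"
    using connected finite_nbrs emult_sym emult_self by (auto simp: lf_multigraph_def verts)
  moreover note inj_labeling
  moreover have "labeling_of MA ` verts G = I"
    by (simp add: labeling_of_def verts)
  moreover have "real_of_int (labeling_of MA v) = (1 / real (degree G v)) *
      (\<Sum>w\<in>nbrs G v. real (emult G v w) * real_of_int (labeling_of MA w))"
    if inner: "v \<in> verts G - leaves G" for v
  proof -
    obtain B where B: "B \<in> MA" "v = center B" using inner unfolding inner_eq by blast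
    obtain a where "a \<in> nbrs G v" using center_two_nbrs[OF B(1)] B(2) by metis
    then have v: "v \<in> verts G" "finite (nbrs G v)" "nbrs G v \<noteq> {}"
      using inner finite_nbrs by (auto simp: verts)
    have "av (ball_mset G (labeling_of MA) v) = real_of_int (labeling_of MA v)"
      unfolding B(2) ball_center[OF B(1)] av_center[OF B(1)] by (simp add: labeling_of_def)
    then show ?thesis using av_ball_iff[OF v(2) inj_labeling v(1,3)] by blast
  qed
  ultimately show ?thesis
    by (auto simp: lf_labeled_mgraphs_def weak_harmonic_labeling_def bij_betw_def)
qed

end

section \<open>The correspondence\<close>

lemma MA_of_in_MH: "X \<in> lf_labeled_mgraphs I \<Longrightarrow> MA_of X \<in> MH I"
  by (cases X) (auto intro: harmonic_mgraph.MA_of_in_MH harmonic_mgraph.intro)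

text \<open>
  The labeling itself is the isomorphism onto the integer multigraph. No edge is lost, since one
  of its end points is not a leaf and the ball around it records the edge.
\<close>

lemma isomorphic_graph_of_MA_of:
  assumes "X \<in> lf_labeled_mgraphs I"
  shows "labeled_isomorphic X (graph_of I (MA_of X), labeling_of (MA_of X))"
proof -
  obtain G l where X: "X = (G, l)" by fastforce
  interpret harmonic_mgraph I G l using assms X by unfold_locales auto
  interpret C: harmonic_collection I "MA_of (G, l)" using MA_of_in_MH by unfold_locales
  have ball: "ball_mset G l v \<in> MA_of (G, l)" "center (ball_mset G l v) = l v" if "v \<in> inner" for v
    using that by (auto simp: MA_of_eq center_def av_ball)
  have inner: "emult C.G (l v) (l w) = emult G v w"
    if "v \<in> inner" "w \<in> verts G" "v \<noteq> w" for v w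
  proof -
    have "l w \<noteq> l v" using that inj by (auto simp: inj_on_eq_iff)
    then have "emult C.G (l v) (l w) = count (ball_mset G l v) (l w)"
      using C.emult_center[of "ball_mset G l v" "l w"] ball[OF that(1)] by simp
    also have "\<dots> = emult G v w"
      using count_ball[OF finite_nbrs inj] that by auto
    finally show ?thesis .
  qed
  have "emult C.G (l v) (l w) = emult G v w" if vw: "v \<in> verts G" "w \<in> verts G" for v w
  proof -
    consider "v = w" | "v \<noteq> w" "v \<in> inner" | "v \<noteq> w" "w \<in> inner"
      | "v \<noteq> w" "v \<in> leaves G" "w \<in> leaves G"
      using vw by auto
    then show ?thesis
    proof cases
      case 1
      then show ?thesis using vw loopless C.emult_self by simp
    next
      case 2
      then show ?thesis using inner vw by blast
    next
      case 3
      then show ?thesis using inner[of w v] vw sym[of v w] C.emult_sym[of "l v"] by simp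
    next
      case 4
      then have "emult G v w = 0"
        using nbr_of_leaf(2)[OF 4(2), of w] vw by (auto simp: nbrs_def)
      moreover have "l u \<notin> center ` MA_of (G, l)" if u: "u \<in> leaves G" "u \<in> verts G" for u
      proof
        assume "l u \<in> center ` MA_of (G, l)"
        then obtain x where x: "x \<in> inner" "l u = l x" using ball(2) by (auto simp: MA_of_eq)
        then have "u = x" using inj_onD[OF inj x(2) u(2)] by simp
        then show False using u(1) x(1) by simp
      qed
      then have "\<not> joined (MA_of (G, l)) (l v) (l w) k" for k
        using C.joined_imp_center 4 vw by blast
      then have "emult C.G (l v) (l w) = 0" by (auto simp: graph_of_def)
      ultimately show ?thesis by simp
    qed
  qed
  then have "mgraph_iso l G l C.G (labeling_of (MA_of (G, l)))"
    using inj image by unfold_locales (auto simp: bij_betw_def C.verts labeling_of_def)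
  then show ?thesis unfolding X labeled_isomorphic_iff by blast
qed

lemma labeled_mgraphs_iff:
  assumes "X \<in> lf_labeled_mgraphs I"
  shows "X \<in> labeled_mgraphs I \<longleftrightarrow> MA_of X \<in> MH_bounded I"
proof -
  obtain G l where X: "X = (G, l)" by fastforce
  interpret harmonic_mgraph I G l using assms X by unfold_locales auto
  show ?thesis
    using assms bounded_degree_iff MA_of_in_MH
    by (auto simp: X labeled_mgraphs_def lf_labeled_mgraphs_def multigraph_def MH_bounded_def)
qed

lemma MA_of_respects: "MA_of respects labeled_iso I"
  by (auto simp: congruent_def labeled_iso_def intro!: MA_of_isomorphic)

lemma MA_of_class_eq:
  assumes "X \<in> lf_labeled_mgraphs I"
  shows "MA_of_class (labeled_iso I `` {X}) = MA_of X"
proof -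
  have "X \<in> labeled_iso I `` {X}"
    using assms by (simp add: labeled_iso_def labeled_isomorphic_refl)
  moreover have "MA_of Y = MA_of X" if "Y \<in> labeled_iso I `` {X}" for Y
    using that MA_of_isomorphic[of X Y] by (simp add: labeled_iso_def)
  ultimately have "MA_of ` (labeled_iso I `` {X}) = {MA_of X}" by blast
  then show ?thesis by (simp add: MA_of_class_def)
qed

lemma class_of_MA_of:
  fixes X :: "'a labeled_mgraph"
  assumes "X \<in> lf_labeled_mgraphs I"
  shows "class_of_MA I (MA_of X) = labeled_iso I `` {X}"
proof -
  note iso = isomorphic_graph_of_MA_of[OF assms]
  have "labeled_isomorphic (graph_of I (MA_of X), labeling_of (MA_of X)) Y \<longleftrightarrow>
      labeled_isomorphic X Y" for Y :: "'a labeled_mgraph"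
    using labeled_isomorphic_trans[OF iso] labeled_isomorphic_trans[OF labeled_isomorphic_sym[OF iso]]
    by metis
  then show ?thesis using assms by (simp add: class_of_MA_def labeled_iso_def Image_singleton)
qed

lemma ex_realization:
  assumes "MA \<in> MH I" "I \<noteq> {}" "infinite (UNIV :: 'a set)"
  obtains X :: "'a labeled_mgraph" where "X \<in> lf_labeled_mgraphs I" "MA_of X = MA"
proof -
  interpret harmonic_collection I MA using assms(1) by unfold_locales
  obtain X :: "'a labeled_mgraph" where X: "labeled_isomorphic (G, labeling_of MA) X"
    using ex_isomorphic_copy[OF assms(3)] by blast
  show ?thesis
  proof (rule that)
    show "X \<in> lf_labeled_mgraphs I"
      using lf_labeled_isomorphic[OF X graph_in_lf[OF assms(2)]] .
    show "MA_of X = MA"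
      using MA_of_isomorphic[OF X] MA_of_graph by simp
  qed
qed

text \<open>
  Surjectivity suffices here: labeled multigraphs with the same balls are isomorphic, as each is
  isomorphic to the integer multigraph built from them. The lemma covers both the locally finite
  case and that of bounded degree.
\<close>

lemma mutually_inverse_on_classes:
  fixes \<X> :: "'a labeled_mgraph set"
  assumes "\<X> \<subseteq> lf_labeled_mgraphs I" "MA_of ` \<X> \<subseteq> \<M>"
    and "\<And>MA. MA \<in> \<M> \<Longrightarrow> \<exists>X\<in>\<X>. MA_of X = MA"
  shows "mutually_inverse (\<X> // labeled_iso I) \<M> MA_of_class (class_of_MA I)"
  unfolding mutually_inverse_def
proof (intro conjI ballI)
  fix c assume "c \<in> \<X> // labeled_iso I"
  then obtain X where X: "X \<in> \<X>" "c = labeled_iso I `` {X}" by (auto elim: quotientE)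
  then have "X \<in> lf_labeled_mgraphs I" "MA_of X \<in> \<M>" using assms(1,2) by blast+
  then show "MA_of_class c \<in> \<M>" "class_of_MA I (MA_of_class c) = c"
    by (simp_all add: X(2) MA_of_class_eq class_of_MA_of)
next
  fix MA assume "MA \<in> \<M>"
  then obtain X where X: "X \<in> \<X>" "MA_of X = MA" using assms(3) by blast
  then have lf: "X \<in> lf_labeled_mgraphs I" using assms(1) by blast
  show "class_of_MA I MA \<in> \<X> // labeled_iso I"
    using class_of_MA_of[OF lf] quotientI[OF X(1)] X(2) by simp
  show "MA_of_class (class_of_MA I MA :: 'a labeled_mgraph set) = MA"
    using class_of_MA_of[OF lf] MA_of_class_eq[OF lf] X(2) by simp
qed

theorem theorem25:
  fixes I :: "int set"
  assumes "integer_interval I"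
    and "infinite (UNIV :: 'a set)"
  shows
    "(MA_of :: 'a labeled_mgraph \<Rightarrow> int multiset set) respects labeled_iso I \<and>
     (\<forall>MA\<in>MH I. \<forall>i\<in>I. \<forall>j\<in>I. \<forall>k\<ge>1. i \<noteq> j \<longrightarrow>
        (emult (graph_of I MA) i j = k \<longleftrightarrow> joined MA i j k)) \<and>
     mutually_inverse (MG I :: 'a labeled_mgraph set set) (MH_bounded I)
       MA_of_class (class_of_MA I) \<and>
     mutually_inverse (MG_lf I :: 'a labeled_mgraph set set) (MH I)
       MA_of_class (class_of_MA I)"
proof (intro conjI)
  have I: "I \<noteq> {}" using assms(1) by (simp add: integer_interval_def)
  show "(MA_of :: 'a labeled_mgraph \<Rightarrow> int multiset set) respects labeled_iso I"
    by (rule MA_of_respects)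
  show "\<forall>MA\<in>MH I. \<forall>i\<in>I. \<forall>j\<in>I. \<forall>k\<ge>1. i \<noteq> j \<longrightarrow>
      (emult (graph_of I MA) i j = k \<longleftrightarrow> joined MA i j k)"
    using harmonic_collection.emult_iff_joined harmonic_collection.intro by blast
  show "mutually_inverse (MG_lf I :: 'a labeled_mgraph set set) (MH I)
      MA_of_class (class_of_MA I)"
    unfolding MG_lf_def
    by (rule mutually_inverse_on_classes) (use MA_of_in_MH ex_realization[OF _ I assms(2)] in blast)+
  show "mutually_inverse (MG I :: 'a labeled_mgraph set set) (MH_bounded I)
      MA_of_class (class_of_MA I)"
    unfolding MG_def
  proof (rule mutually_inverse_on_classes)
    show sub: "labeled_mgraphs I \<subseteq> (lf_labeled_mgraphs I :: 'a labeled_mgraph set)"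
      by (auto simp: labeled_mgraphs_def lf_labeled_mgraphs_def multigraph_def)
    show "MA_of ` (labeled_mgraphs I :: 'a labeled_mgraph set) \<subseteq> MH_bounded I"
      using sub labeled_mgraphs_iff by blast
    show "\<exists>X\<in>(labeled_mgraphs I :: 'a labeled_mgraph set). MA_of X = MA"
      if MA: "MA \<in> MH_bounded I" for MA
    proof -
      have "MA \<in> MH I" using MA by (simp add: MH_bounded_def)
      then obtain X :: "'a labeled_mgraph" where "X \<in> lf_labeled_mgraphs I" "MA_of X = MA"
        using ex_realization[OF _ I assms(2)] by blast
      then show ?thesis using MA labeled_mgraphs_iff by blast
    qed
  qed
qed

end
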